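(* Let $\mathbb{K}$ be an algebraically closed field, $V$ a $\mathbb{K}$-vector space of finite positive dimension, and $\Phi=(A;\{E_i\}_{i=0}^d;A^*;\{E_i^*\}_{i=0}^d)$ a TD system on $V$ of diameter $d\geq 1$ that has $q$-Racah type, with fixed associated scalars $q,a,b$. Let the invertible map $\mathcal{M}\in\mathrm{End}(V)$ be as defined in the context. Then for $0\leq i\leq d$, $$(\mathcal{M} -q^{d-2i}I)E_i^*V\subseteq E_0^*V+E_1^*V+\cdots+E_{i-1}^*V,$$ $$(\mathcal{M}^{-1} -q^{2i-d}I)E_i^*V\subseteq E_0^*V+E_1^*V+\cdots+E_{i-1}^*V.$$
   Context: TD pair: an ordered pair of linear maps $A,A^*:V\to V$ such that (i) each is diagonalizable; (ii) there is an ordering $\{V_i\}_{i=0}^d$ of the eigenspaces of $A$ with $A^*V_i\subseteq V_{i-1}+V_i+V_{i+1}$ for $0\le i\le d$ ($V_{-1}=V_{d+1}=0$); (iii) there is an ordering $\{V_i^*\}_{i=0}^\delta$ of the eigenspaces of $A^*$ with $AV_i^*\subseteq V_{i-1}^*+V_i^*+V_{i+1}^*$ for $0\le i\le\delta$ ($V^*_{-1}=V^*_{\delta+1}=0$); (iv) no subspace $W$ with $0\ne W\ne V$ satisfies $AW\subseteq W$ and $A^*W\subseteq W$. It is known that $d=\delta$; $d$ is called the diameter. Orderings as in (ii), (iii) are called standard. The primitive idempotent of $A$ for an eigenspace $V_i$ is the projection of $V$ onto $V_i$ that vanishes on the other eigenspaces (similarly for $A^*$). TD system: $(A;\{E_i\}_{i=0}^d;A^*;\{E_i^*\}_{i=0}^d)$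 where $A,A^*$ is a TD pair and $\{E_i\}$, $\{E_i^*\}$ are the primitive idempotents of $A$, $A^*$, in orders for which the corresponding eigenspace orderings $\{E_iV\}$, $\{E_i^*V\}$ are standard. Let $\theta_i$ (resp. $\theta_i^*$) be the eigenvalue of $A$ on $E_iV$ (resp. of $A^*$ on $E_i^*V$). $\Phi$ has $q$-Racah type if there are nonzero $q,a,b\in\mathbb{K}$ with $q^4\ne1$ and $\theta_i=aq^{d-2i}+a^{-1}q^{2i-d}$, $\theta_i^*=bq^{d-2i}+b^{-1}q^{2i-d}$ for $0\le i\le d$. (Distinctness of eigenvalues forces $q^{2i}\neq1$ for $1\le i\le d$, and $a^2\ne q^{2d-2},q^{2d-4},\dots,q^{2-2d}$; in particular $a^2\neq 1$.) Split decompositions: $U_i=(E_0^*V+\cdots+E_i^*V)\cap(E_iV+\cdots+E_dV)$ and $U_i^\Downarrow=(E_0^*V+\cdots+E_i^*V)\cap(E_0V+\cdots+E_{d-i}V)$ for $0\le i\le d$. It is known that $V=\bigoplus_i U_i=\bigoplus_i U_i^\Downarrow$ with all summands nonzero. $K,B\in\mathrm{End}(V)$ are the linear maps acting on $U_i$, respectively $U_i^\Downarrow$, as the scalar $q^{d-2i}$ ($0\le i\le d$). $\mathcal{M}\in\mathrm{End}(V)$: $\mathcal{M}=\dfrac{aK-a^{-1}B}{a-a^{-1}}$; it is invertible (it is known that $aI-a^{-1}BK^{-1}$ is invertible). Empty sums of subspaces are $0$. *)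

theory Defs
  imports
    "HOL-Computational_Algebra.Polynomial"
    "HOL-Library.Set_Algebras"
begin

text \<open>
  The space \<open>V\<close> is the whole type \<open>'b\<close>. Sums of subspaces, written \<open>W + W'\<close> or
  \<open>\<Sum>j\<in>J. W j\<close>, are the elementwise sums of sets from the theory \<open>Set_Algebras\<close>;
  in particular the empty sum is \<open>{0}\<close>. Families indexed by \<open>0, \<dots>, d\<close> are functions
  on \<open>nat\<close> of which only the values at indices \<open>i \<le> d\<close> matter.
  A prime stands for the star: \<open>A'\<close> is \<open>A\<^sup>*\<close> and \<open>E' i\<close> is the idempotent \<open>E\<^sub>i\<^sup>*\<close>.
\<close>

context
  fixes scale :: "'a::field \<Rightarrow> 'b::ab_group_add \<Rightarrow> 'b"  (infixr \<open>*s\<close> 75)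
begin

definition eigenspace :: "('b \<Rightarrow> 'b) \<Rightarrow> 'a \<Rightarrow> 'b set" where
  "eigenspace f \<theta> = {v. f v = \<theta> *s v}"

definition eigenspaces :: "('b \<Rightarrow> 'b) \<Rightarrow> 'b set set" where
  "eigenspaces f = {eigenspace f \<theta> | \<theta>. eigenspace f \<theta> \<noteq> {0}}"

definition diagonalizable :: "('b \<Rightarrow> 'b) \<Rightarrow> bool" where
  "diagonalizable f \<longleftrightarrow> module.span scale (\<Union>(eigenspaces f)) = UNIV"

text \<open>
  The index set below is \<open>{i - 1, i, i + 1}\<close> cut down to \<open>{0, \<dots>, d}\<close>, which
  encodes \<open>W\<^bsub>-1\<^esub> = W\<^bsub>d+1\<^esub> = 0\<close>.
\<close>

definition standard_ordering :: "('b \<Rightarrow> 'b) \<Rightarrow> ('b \<Rightarrow> 'b) \<Rightarrow> nat \<Rightarrow> (nat \<Rightarrow> 'b set) \<Rightarrow> bool" where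
  "standard_ordering A A' d W \<longleftrightarrow>
     bij_betw W {..d} (eigenspaces A) \<and>
     (\<forall>i\<le>d. A' ` W i \<subseteq> (\<Sum>j\<in>{j. j \<le> d \<and> \<bar>int j - int i\<bar> \<le> 1}. W j))"

definition TD_pair :: "('b \<Rightarrow> 'b) \<Rightarrow> ('b \<Rightarrow> 'b) \<Rightarrow> bool" where
  "TD_pair A A' \<longleftrightarrow>
     Vector_Spaces.linear scale scale A \<and> Vector_Spaces.linear scale scale A' \<and>
     diagonalizable A \<and> diagonalizable A' \<and>
     (\<exists>d W. standard_ordering A A' d W) \<and>
     (\<exists>\<delta> W. standard_ordering A' A \<delta> W) \<and>
     (\<forall>W. module.subspace scale W \<and> A ` W \<subseteq> W \<and> A' ` W \<subseteq> W \<longrightarrow> W = {0} \<or> W = UNIV)"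

definition primitive_idempotent :: "('b \<Rightarrow> 'b) \<Rightarrow> 'b set \<Rightarrow> ('b \<Rightarrow> 'b) \<Rightarrow> bool" where
  "primitive_idempotent f W E \<longleftrightarrow>
     W \<in> eigenspaces f \<and> Vector_Spaces.linear scale scale E \<and>
     range E = W \<and> (\<forall>v\<in>W. E v = v) \<and>
     (\<forall>W'\<in>eigenspaces f - {W}. \<forall>v\<in>W'. E v = 0)"

definition TD_system ::
  "('b \<Rightarrow> 'b) \<Rightarrow> (nat \<Rightarrow> 'b \<Rightarrow> 'b) \<Rightarrow> ('b \<Rightarrow> 'b) \<Rightarrow> (nat \<Rightarrow> 'b \<Rightarrow> 'b) \<Rightarrow> nat \<Rightarrow> bool" where
  "TD_system A E A' E' d \<longleftrightarrow>
     TD_pair A A' \<and>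
     (\<forall>i\<le>d. primitive_idempotent A (range (E i)) (E i)) \<and>
     (\<forall>i\<le>d. primitive_idempotent A' (range (E' i)) (E' i)) \<and>
     standard_ordering A A' d (\<lambda>i. range (E i)) \<and>
     standard_ordering A' A d (\<lambda>i. range (E' i))"

definition q_Racah ::
  "('b \<Rightarrow> 'b) \<Rightarrow> (nat \<Rightarrow> 'b \<Rightarrow> 'b) \<Rightarrow> ('b \<Rightarrow> 'b) \<Rightarrow> (nat \<Rightarrow> 'b \<Rightarrow> 'b) \<Rightarrow> nat \<Rightarrow> 'a \<Rightarrow> 'a \<Rightarrow> 'a \<Rightarrow> bool"
where
  "q_Racah A E A' E' d q a b \<longleftrightarrow>
     q \<noteq> 0 \<and> a \<noteq> 0 \<and> b \<noteq> 0 \<and> q ^ 4 \<noteq> 1 \<and>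
     (\<forall>i\<le>d. \<forall>v\<in>range (E i).
        A v = (a * q powi (int d - 2 * int i) + inverse a * q powi (2 * int i - int d)) *s v) \<and>
     (\<forall>i\<le>d. \<forall>v\<in>range (E' i).
        A' v = (b * q powi (int d - 2 * int i) + inverse b * q powi (2 * int i - int d)) *s v)"

text \<open>
  \<open>split1\<close> is the decomposition \<open>U\<^sub>i\<close>, and \<open>split2\<close> is \<open>U\<^sub>i\<close> with superscript \<open>\<Down>\<close>.
\<close>

definition split1 :: "(nat \<Rightarrow> 'b \<Rightarrow> 'b) \<Rightarrow> (nat \<Rightarrow> 'b \<Rightarrow> 'b) \<Rightarrow> nat \<Rightarrow> nat \<Rightarrow> 'b set" where
  "split1 E E' d i = (\<Sum>j\<in>{0..i}. range (E' j)) \<inter> (\<Sum>j\<in>{i..d}. range (E j))"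

definition split2 :: "(nat \<Rightarrow> 'b \<Rightarrow> 'b) \<Rightarrow> (nat \<Rightarrow> 'b \<Rightarrow> 'b) \<Rightarrow> nat \<Rightarrow> nat \<Rightarrow> 'b set" where
  "split2 E E' d i = (\<Sum>j\<in>{0..i}. range (E' j)) \<inter> (\<Sum>j\<in>{0..d - i}. range (E j))"

text \<open>
  The map below is uniquely determined whenever \<open>V\<close> is the direct sum of
  \<open>U 0, \<dots>, U d\<close>, which is the case for both split decompositions of a TD system.
\<close>

definition decomposition_map :: "nat \<Rightarrow> 'a \<Rightarrow> (nat \<Rightarrow> 'b set) \<Rightarrow> 'b \<Rightarrow> 'b" where
  "decomposition_map d q U =
     (THE f. Vector_Spaces.linear scale scale f \<and>
        (\<forall>i\<le>d. \<forall>u\<in>U i. f u = (q powi (int d - 2 * int i)) *s u))"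

definition K_map :: "(nat \<Rightarrow> 'b \<Rightarrow> 'b) \<Rightarrow> (nat \<Rightarrow> 'b \<Rightarrow> 'b) \<Rightarrow> nat \<Rightarrow> 'a \<Rightarrow> 'b \<Rightarrow> 'b" where
  "K_map E E' d q = decomposition_map d q (split1 E E' d)"

definition B_map :: "(nat \<Rightarrow> 'b \<Rightarrow> 'b) \<Rightarrow> (nat \<Rightarrow> 'b \<Rightarrow> 'b) \<Rightarrow> nat \<Rightarrow> 'a \<Rightarrow> 'b \<Rightarrow> 'b" where
  "B_map E E' d q = decomposition_map d q (split2 E E' d)"

definition M_map :: "(nat \<Rightarrow> 'b \<Rightarrow> 'b) \<Rightarrow> (nat \<Rightarrow> 'b \<Rightarrow> 'b) \<Rightarrow> nat \<Rightarrow> 'a \<Rightarrow> 'a \<Rightarrow> 'b \<Rightarrow> 'b" where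
  "M_map E E' d q a v =
     inverse (a - inverse a) *s (a *s K_map E E' d q v - inverse a *s B_map E E' d q v)"

end

end

theory Submission
  imports Defs
begin

text \<open>
  Put \<open>F i = E\<^sub>0\<^sup>*V + \<dots> + E\<^bsub>i-1\<^esub>\<^sup>*V\<close> and \<open>G j = E\<^sub>jV + \<dots> + E\<^sub>dV\<close>. For each \<open>r\<close> the
  sum of the spaces \<open>F (i + 1) \<inter> G (i + r)\<close> over all \<open>i\<close> is invariant under \<open>A\<close> and \<open>A\<^sup>*\<close>,
  hence \<open>0\<close> for \<open>r = 1\<close> and \<open>V\<close> for \<open>r = 0\<close>. Therefore \<open>V\<close> is the direct sum of the \<open>U\<^sub>i\<close>
  and \<open>F (i + 1) = U\<^sub>0 + \<dots> + U\<^sub>i\<close>, so that \<open>K\<close> acts on \<open>F (i + 1) / F i\<close> as \<open>q\<^bsup>d-2i\<^esup>\<close>.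
  Reversing the order of the \<open>E\<^sub>i\<close> gives the same for \<open>B\<close>, hence for their affine combination
  \<open>\<M>\<close>. A map that is triangular with respect to the flag \<open>F\<close> with nonzero diagonal is
  invertible, and its inverse is triangular with the inverse diagonal.
\<close>

section \<open>Linear algebra: sums as spans, and maps triangular on a flag\<close>

context vector_space
begin

lemma sum_subspaces_eq_span:
  assumes "finite J" "\<And>j. j \<in> J \<Longrightarrow> subspace (W j)"
  shows "(\<Sum>j\<in>J. W j) = span (\<Union>j\<in>J. W j)"
  using assms
proof (induction J)
  case empty
  then show ?case by (simp add: set_zero)
next
  case (insert j J)
  have "span (W j) = W j"
    using insert.prems by simp
  then have "W j + (\<Sum>j\<in>J. W j) = span (W j) + span (\<Union>j\<in>J. W j)"
    using insert.IH insert.prems by (metis insertCI)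
  also have "\<dots> = span (W j \<union> (\<Union>j\<in>J. W j))"
    by (auto simp: span_Un set_plus_def)
  finally show ?case
    using insert.hyps by simp
qed

lemma linear_span_into:
  assumes "Vector_Spaces.linear scale scale f" "subspace T" "\<And>x. x \<in> S \<Longrightarrow> f x \<in> T" "x \<in> span S"
  shows "f x \<in> T"
proof -
  interpret f: Vector_Spaces.linear scale scale f by fact
  have "f ` span S = span (f ` S)"
    by (simp add: f.span_image)
  also have "\<dots> \<subseteq> T"
    using assms by (intro span_minimal) auto
  finally show ?thesis using assms(4) by auto
qed

lemma linear_diff_scale:
  assumes "Vector_Spaces.linear scale scale f"
  shows "Vector_Spaces.linear scale scale (\<lambda>x. f x - scale c x)"
proof -
  interpret f: Vector_Spaces.linear scale scale f by fact
  show ?thesis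
    by unfold_locales
      (simp_all add: f.add f.scale scale_right_distrib scale_right_diff_distrib mult.commute)
qed

text \<open>Nonzero diagonal entries allow solving one flag step at a time: a kernel vector sinks
  through the flag to \<open>0\<close>, and preimages are built upwards from \<open>F 0\<close>. A
  vector of \<open>F i\<close> has its preimage in \<open>F i\<close>, which makes the inverse
  triangular too.\<close>

lemma triangular_inverse:
  assumes lin: "Vector_Spaces.linear scale scale f"
    and sub: "\<And>i. subspace (F i)" and F0: "F 0 = {0}" and Fn: "F n = UNIV"
    and tri: "\<And>i x. i < n \<Longrightarrow> x \<in> F (Suc i) \<Longrightarrow> f x - scale (c i) x \<in> F i"
    and mono: "\<And>i. F i \<subseteq> F (Suc i)"
    and nz: "\<And>i. i < n \<Longrightarrow> c i \<noteq> 0"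
    and i: "i < n" and x: "x \<in> F (Suc i)"
  shows "inv f x - scale (inverse (c i)) x \<in> F i"
proof -
  interpret f: Vector_Spaces.linear scale scale f by fact
  have ker: "v = 0" if "f v = 0" for v
  proof -
    \<comment> \<open>If \<open>f v = 0\<close> and \<open>v\<close> lies in
      \<open>F (Suc j)\<close>, triangularity puts \<open>c j\<close> times \<open>v\<close> in
      \<open>F j\<close>, and \<open>c j\<close> is invertible. Once \<open>k\<close> reaches
      \<open>n\<close>, truncated subtraction keeps the index at \<open>0\<close>.\<close>
    have "v \<in> F (n - k)" for k
    proof (induction k)
      case 0
      show ?case using Fn by simp
    next
      case (Suc k)
      show ?case
      proof (cases "k < n")
        case True
        define j where "j = n - Suc k"
        have j: "j < n" "n - k = Suc j" using True by (auto simp: j_def)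
        have "f v - scale (c j) v \<in> F j" using tri[OF j(1)] Suc j(2) by simp
        then have "scale (inverse (c j)) (- (f v - scale (c j) v)) \<in> F j"
          using sub[of j] by (blast intro: subspace_neg subspace_scale)
        then show ?thesis using that nz[OF j(1)] by (simp add: j_def)
      next
        case False
        then show ?thesis using Suc by simp
      qed
    qed
    from this[of n] show ?thesis using F0 by simp
  qed
  have inj: "inj f"
    using ker by (simp add: f.inj_iff_eq_0)
  have surj: "F k \<subseteq> f ` F k" if "k \<le> n" for k
    using that
  proof (induction k)
    case 0
    then show ?case using F0 f.zero by simp
  next
    case (Suc k)
    show ?case
    proof
      fix w assume w: "w \<in> F (Suc k)"
      \<comment> \<open>\<open>f\<close> sends \<open>scale (inverse (c k)) w\<close> to
        \<open>w\<close> plus this error term; the term lies in \<open>F k\<close>, so the induction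
        hypothesis supplies the correction \<open>y\<close>.\<close>
      have "scale (inverse (c k)) (f w - scale (c k) w) \<in> F k"
        using tri[of k w] w Suc.prems sub[of k] by (simp add: subspace_scale)
      then obtain y where y: "y \<in> F k" "f y = scale (inverse (c k)) (f w - scale (c k) w)"
        using Suc by fastforce
      have "f (scale (inverse (c k)) w - y) = w"
        using y(2) nz[of k] Suc.prems by (simp add: f.diff f.scale scale_right_diff_distrib)
      moreover have "scale (inverse (c k)) w - y \<in> F (Suc k)"
        using w y(1) mono[of k] sub[of "Suc k"] by (blast intro: subspace_diff subspace_scale)
      ultimately show "w \<in> f ` F (Suc k)" by force
    qed
  qed
  have bij: "bij f"
    using surj[of n] Fn inj by (auto simp: bij_def)
  \<comment> \<open>This choice gives \<open>f (x - y) = scale (c i) x\<close>, so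
    \<open>inv f x\<close> misses its diagonal value only by a multiple of \<open>y\<close>.\<close>
  obtain y where y: "y \<in> F i" "f y = f x - scale (c i) x"
    using surj[of i] tri[OF i x] i by fastforce
  have "f (scale (inverse (c i)) (x - y)) = x"
    using y(2) nz[OF i] by (simp add: f.diff f.scale)
  then have "inv f x = scale (inverse (c i)) (x - y)"
    using inj by (metis inv_f_f)
  then have "inv f x - scale (inverse (c i)) x = - scale (inverse (c i)) y"
    by (simp add: scale_right_diff_distrib)
  then show ?thesis
    using y(1) sub[of i] by (simp add: subspace_neg subspace_scale)
qed

end

section \<open>Two flags and the split decomposition they induce\<close>

text \<open>
  The index of \<open>F\<close> is shifted by one against the usual convention so that \<open>F 0 = {0}\<close>.
  Beyond \<open>d\<close> both flags are constant, which avoids boundary cases at \<open>i = d\<close>.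
\<close>

locale flag_pair = vector_space scale
  for scale :: "'a::field \<Rightarrow> 'b::ab_group_add \<Rightarrow> 'b" (infixr \<open>*s\<close> 75) +
  fixes A A' :: "'b \<Rightarrow> 'b" and F G :: "nat \<Rightarrow> 'b set" and d :: nat
  assumes linear_A: "Vector_Spaces.linear scale scale A"
    and linear_A': "Vector_Spaces.linear scale scale A'"
    and subspace_F: "subspace (F i)" and subspace_G: "subspace (G i)"
    and F_mono: "F i \<subseteq> F (Suc i)" and G_antimono: "G (Suc i) \<subseteq> G i"
    and F_0: "F 0 = {0}" and F_top: "d < i \<Longrightarrow> F i = UNIV"
    and G_0: "G 0 = UNIV" and G_bot: "d < i \<Longrightarrow> G i = {0}"
    and F_1: "F (Suc 0) \<noteq> {0}" and G_1: "G (Suc 0) \<noteq> UNIV"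
    and A_F: "x \<in> F i \<Longrightarrow> A x \<in> F (Suc i)"
    and A_G: "\<exists>c. \<forall>x\<in>G i. A x - c *s x \<in> G (Suc i)"
    and A'_G: "x \<in> G (Suc i) \<Longrightarrow> A' x \<in> G i"
    and A'_F: "\<exists>c. \<forall>x\<in>F (Suc i). A' x - c *s x \<in> F i"
    and irreducible:
      "\<lbrakk>subspace W; A ` W \<subseteq> W; A' ` W \<subseteq> W\<rbrakk> \<Longrightarrow> W = {0} \<or> W = UNIV"
begin

lemma F_mono': "i \<le> j \<Longrightarrow> F i \<subseteq> F j"
  by (rule lift_Suc_mono_le[of F]) (rule F_mono)

lemma G_antimono': "i \<le> j \<Longrightarrow> G j \<subseteq> G i"
  by (rule lift_Suc_antimono_le[of G]) (rule G_antimono)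

text \<open>Up to a scalar multiple of the argument, \<open>A\<close> sends the piece with index
  \<open>i\<close> into the piece \<open>i + 1\<close>, and \<open>A'\<close> sends it into the
  piece \<open>i - 1\<close>. So the span is invariant under both maps and irreducibility
  applies.\<close>

lemma diagonal_span_trivial:
  "span (\<Union>i. F (Suc i) \<inter> G (i + r)) \<in> {{0}, UNIV}" (is "span ?S \<in> _")
proof -
  have "A x \<in> span ?S" if xS: "x \<in> ?S" for x
  proof -
    obtain i where x: "x \<in> F (Suc i)" "x \<in> G (i + r)" using xS by blast
    obtain c where "A x - c *s x \<in> G (Suc (i + r))" using A_G x(2) by blast
    moreover have "A x - c *s x \<in> F (Suc (Suc i))"
      using A_F[OF x(1)] F_mono[of "Suc i"] x(1) subspace_F
      by (blast intro: subspace_diff subspace_scale)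
    ultimately have "A x - c *s x \<in> ?S" by (intro UN_I[of "Suc i"]) auto
    then have "(A x - c *s x) + c *s x \<in> span ?S"
      using xS by (blast intro: span_base span_add span_scale)
    then show ?thesis by simp
  qed
  then have 1: "A ` span ?S \<subseteq> span ?S"
    using linear_span_into[OF linear_A] by blast
  have "A' x \<in> span ?S" if xS: "x \<in> ?S" for x
  proof -
    obtain i where x: "x \<in> F (Suc i)" "x \<in> G (i + r)" using xS by blast
    obtain c where c: "A' x - c *s x \<in> F i" using A'_F x(1) by blast
    have "A' x - c *s x \<in> span ?S"
    \<comment> \<open>There is no piece below index \<open>0\<close>, but there the remainder lies
      in \<open>F 0 = {0}\<close>.\<close>
    proof (cases i)
      case 0
      then show ?thesis using c F_0 by (simp add: span_zero)
    next
      case (Suc k)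
      have "A' x - c *s x \<in> G (k + r)"
        using A'_G[of x "k + r"] G_antimono[of "k + r"] x(2) Suc subspace_G[of "k + r"]
        by (auto intro: subspace_diff subspace_scale)
      then show ?thesis using c Suc by (blast intro: span_base)
    qed
    then have "(A' x - c *s x) + c *s x \<in> span ?S"
      using xS by (blast intro: span_base span_add span_scale)
    then show ?thesis by simp
  qed
  then have "A' ` span ?S \<subseteq> span ?S"
    using linear_span_into[OF linear_A'] by blast
  with 1 irreducible[of "span ?S"] show ?thesis by auto
qed

text \<open>For \<open>r = 1\<close> every piece lies in the proper subspace
  \<open>G (Suc 0)\<close>, which rules out \<open>UNIV\<close> for the span. For
  \<open>i = Suc k\<close> the intersection is the piece with index \<open>k\<close>.\<close>

lemma F_inter_G: "F i \<inter> G i = {0}"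
proof (cases i)
  case 0
  then show ?thesis using F_0 G_0 by simp
next
  case (Suc k)
  let ?S = "\<Union>i. F (Suc i) \<inter> G (i + 1)"
  have "?S \<subseteq> G (Suc 0)" using G_antimono'[of "Suc 0"] by fastforce
  then have "span ?S \<subseteq> G (Suc 0)" using subspace_G by (rule span_minimal)
  then have "span ?S = {0}" using diagonal_span_trivial[of 1] G_1 by auto
  moreover have "F i \<inter> G i \<subseteq> span ?S"
    using Suc by (auto intro!: span_base)
  ultimately show ?thesis
    using subspace_F[of i] subspace_G[of i] by (auto simp: subspace_0)
qed

text \<open>For \<open>r = 0\<close> the piece with index \<open>0\<close> is
  \<open>F (Suc 0)\<close>, which rules out \<open>{0}\<close> for the span. Pieces beyond
  \<open>d\<close> vanish with \<open>G\<close>, leaving a finite sum.\<close>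

lemma split_decomposition:
  obtains u where "\<And>i. i \<le> d \<Longrightarrow> u i \<in> F (Suc i) \<inter> G i" "v = (\<Sum>i\<le>d. u i)"
proof -
  let ?S = "\<Union>i. F (Suc i) \<inter> G (i + 0)" and ?T = "\<Union>i\<in>{..d}. F (Suc i) \<inter> G i"
  have "F (Suc 0) \<subseteq> span ?S" using G_0 by (auto intro!: span_base intro: exI[of _ 0])
  then have "span ?S \<noteq> {0}" using F_1 subspace_0[OF subspace_F[of "Suc 0"]] by auto
  then have "span ?S = UNIV" using diagonal_span_trivial[of 0] by auto
  moreover have "?S \<subseteq> span ?T"
  proof
    fix x assume "x \<in> ?S"
    then obtain i where "x \<in> F (Suc i) \<inter> G i" by auto
    then show "x \<in> span ?T"
      using G_bot[of i] by (cases "i \<le> d") (auto intro!: span_base simp: span_zero)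
  qed
  ultimately have "span ?T = UNIV"
    using span_minimal[OF _ subspace_span] by blast
  then have "(\<Sum>i\<in>{..d}. F (Suc i) \<inter> G i) = UNIV"
    by (subst sum_subspaces_eq_span) (auto intro: subspace_inter subspace_F subspace_G)
  then have "v \<in> (\<Sum>i\<in>{..d}. F (Suc i) \<inter> G i)" by simp
  then show thesis
    using that by (auto simp: set_sum_alt)
qed

text \<open>Directness of the sum: once the terms before \<open>i\<close> vanish, \<open>z i\<close>
  is minus the sum of the later ones, hence in \<open>G (Suc i)\<close> as well as in
  \<open>F (Suc i)\<close>.\<close>

lemma split_zero:
  assumes "\<And>i. i \<le> d \<Longrightarrow> z i \<in> F (Suc i) \<inter> G i" "(\<Sum>i\<le>d. z i) = 0" "i \<le> d"
  shows "z i = 0"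
  using assms(3)
proof (induction i rule: less_induct)
  case (less i)
  have "{..d} = {..<i} \<union> {i} \<union> {i<..d}" "{..<i} \<inter> {i<..d} = {}" using less.prems by auto
  then have "(\<Sum>j\<le>d. z j) = (\<Sum>j<i. z j) + z i + (\<Sum>j\<in>{i<..d}. z j)"
    by (simp add: sum.union_disjoint)
  moreover have "(\<Sum>j<i. z j) = 0" using less by simp
  ultimately have eq: "z i = - (\<Sum>j\<in>{i<..d}. z j)"
    using assms(2) by (simp add: eq_neg_iff_add_eq_0)
  have "(\<Sum>j\<in>{i<..d}. z j) \<in> G (Suc i)"
    using assms(1) G_antimono'[of "Suc i"]
    by (intro subspace_sum subspace_G)
      (metis IntD2 Suc_leI greaterThanAtMost_iff subsetD)
  then have "z i \<in> G (Suc i)"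
    unfolding eq by (rule subspace_neg[OF subspace_G])
  then have "z i \<in> F (Suc i) \<inter> G (Suc i)"
    using assms(1)[OF less.prems] by blast
  then show ?case using F_inter_G by auto
qed

text \<open>Justifies the definite description in \<open>decomposition_map\<close>: components along
  a direct sum are unique, hence linear in the vector, and rescaling them gives the map.\<close>

lemma decomposition_map_ex1:
  "\<exists>!f. Vector_Spaces.linear scale scale f \<and> (\<forall>i\<le>d. \<forall>u\<in>F (Suc i) \<inter> G i. f u = c i *s u)"
proof -
  let ?U = "\<lambda>i. F (Suc i) \<inter> G i"
  have sub: "subspace (?U i)" for i by (intro subspace_inter subspace_F subspace_G)
  have "\<exists>u. (\<forall>i\<le>d. u i \<in> ?U i) \<and> v = (\<Sum>i\<le>d. u i)" for v
    using split_decomposition[of v] by metis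
  then obtain u where u: "\<And>v i. i \<le> d \<Longrightarrow> u v i \<in> ?U i" "\<And>v. v = (\<Sum>i\<le>d. u v i)"
    by metis
  \<comment> \<open>\<open>u\<close> is merely a choice of components; uniqueness then yields
    additivity, homogeneity and the components of a vector of a single summand.\<close>
  have uniq: "u v i = w i" if w: "\<And>i. i \<le> d \<Longrightarrow> w i \<in> ?U i" "v = (\<Sum>i\<le>d. w i)" and "i \<le> d" for v w i
  proof -
    have "u v i - w i = 0"
    proof (rule split_zero[of "\<lambda>i. u v i - w i"])
      show "u v i - w i \<in> ?U i" if "i \<le> d" for i
        using u(1)[OF that] w(1)[OF that] by (intro subspace_diff sub)
      show "(\<Sum>i\<le>d. u v i - w i) = 0"
        using u(2)[of v] w(2) by (simp add: sum_subtractf)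
    qed fact
    then show ?thesis by simp
  qed
  define f where "f v = (\<Sum>i\<le>d. c i *s u v i)" for v
  have "u (v + w) i = u v i + u w i" if "i \<le> d" for v w i
  proof (rule uniq)
    show "u v i + u w i \<in> ?U i" if "i \<le> d" for i
      using u(1)[OF that] sub by (intro subspace_add) auto
    show "v + w = (\<Sum>i\<le>d. u v i + u w i)"
      using u(2)[of v] u(2)[of w] by (simp add: sum.distrib)
  qed fact
  moreover have "u (r *s v) i = r *s u v i" if "i \<le> d" for r v i
  proof (rule uniq)
    show "r *s u v i \<in> ?U i" if "i \<le> d" for i
      using u(1)[OF that] sub by (intro subspace_scale) auto
    show "r *s v = (\<Sum>i\<le>d. r *s u v i)"
      using u(2)[of v] by (simp flip: scale_sum_right)
  qed fact
  ultimately have lin: "Vector_Spaces.linear scale scale f"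
    by unfold_locales
      (simp_all add: f_def scale_right_distrib sum.distrib scale_sum_right mult.commute)
  have eig: "f x = c i *s x" if i: "i \<le> d" and x: "x \<in> ?U i" for i x
  proof -
    have "u x j = (if j = i then x else 0)" if "j \<le> d" for j
    proof (rule uniq)
      show "(if j = i then x else 0) \<in> ?U j" for j
        using x subspace_0[OF sub] by auto
      show "x = (\<Sum>j\<le>d. if j = i then x else 0)"
        using i by simp
    qed fact
    then have "f x = (\<Sum>j\<le>d. if j = i then c i *s x else 0)"
      unfolding f_def by (intro sum.cong) auto
    then show ?thesis using i by simp
  qed
  show ?thesis
  proof (rule ex1I[of _ f])
    show "Vector_Spaces.linear scale scale f \<and> (\<forall>i\<le>d. \<forall>u\<in>?U i. f u = c i *s u)"
      using lin eig by blast
  next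
    fix g assume g: "Vector_Spaces.linear scale scale g \<and> (\<forall>i\<le>d. \<forall>u\<in>?U i. g u = c i *s u)"
    then interpret g: Vector_Spaces.linear scale scale g by blast
    show "g = f"
    proof
      fix v
      have "g v = g (\<Sum>i\<le>d. u v i)" using u(2)[of v] by simp
      also have "\<dots> = f v"
        unfolding f_def g.sum using g u(1) by (intro sum.cong) auto
      finally show "g v = f v" .
    qed
  qed
qed

text \<open>A vector of \<open>F (Suc i)\<close> has no components beyond \<open>i\<close>.
  Subtracting \<open>c i\<close> times it cancels the component at \<open>i\<close>, and the lower
  ones lie in \<open>F i\<close>.\<close>

lemma split_map_triangular:
  assumes lin: "Vector_Spaces.linear scale scale f"
    and eig: "\<And>i u. i \<le> d \<Longrightarrow> u \<in> F (Suc i) \<inter> G i \<Longrightarrow> f u = c i *s u"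
    and i: "i \<le> d" and v: "v \<in> F (Suc i)"
  shows "f v - c i *s v \<in> F i"
proof -
  interpret f: Vector_Spaces.linear scale scale f by fact
  obtain u where u: "\<And>i. i \<le> d \<Longrightarrow> u i \<in> F (Suc i) \<inter> G i" "v = (\<Sum>i\<le>d. u i)"
    using split_decomposition[of v] by blast
  have uF: "u j \<in> F k" if "j < k" "j \<le> d" for j k
    using u(1)[OF that(2)] F_mono'[of "Suc j" k] that(1) by auto
  have "{..d} = {..i} \<union> {i<..d}" "{..i} \<inter> {i<..d} = {}" using i by auto
  then have split: "v = (\<Sum>j\<le>i. u j) + (\<Sum>j\<in>{i<..d}. u j)"
    by (simp add: u(2) sum.union_disjoint)
  have head: "(\<Sum>j\<le>i. u j) \<in> F (Suc i)"
    using i by (intro subspace_sum subspace_F uF) auto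
  \<comment> \<open>The tail is placed in \<open>F (Suc i)\<close> as a difference and in
    \<open>G (Suc i)\<close> termwise, so it vanishes.\<close>
  have "(\<Sum>j\<in>{i<..d}. u j) = v - (\<Sum>j\<le>i. u j)"
    using split by simp
  then have "(\<Sum>j\<in>{i<..d}. u j) \<in> F (Suc i)"
    using v head subspace_diff[OF subspace_F] by metis
  moreover have "(\<Sum>j\<in>{i<..d}. u j) \<in> G (Suc i)"
    using u(1) G_antimono'[of "Suc i"]
    by (intro subspace_sum subspace_G)
      (metis IntD2 Suc_leI greaterThanAtMost_iff subsetD)
  ultimately have "(\<Sum>j\<in>{i<..d}. u j) = 0"
    using F_inter_G by auto
  then have "v = (\<Sum>j\<le>i. u j)" using split by simp
  moreover have "(\<Sum>j\<le>i. f (u j)) = (\<Sum>j\<le>i. c j *s u j)"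
    by (intro sum.cong refl eig u(1)) (use i in auto)
  ultimately have "f v - c i *s v = (\<Sum>j\<le>i. c j *s u j - c i *s u j)"
    by (simp only: f.sum scale_sum_right sum_subtractf)
  also have "\<dots> \<in> F i"
  proof (intro subspace_sum subspace_F)
    fix j assume "j \<in> {..i}"
    then consider "j = i" | "j < i" by force
    then show "c j *s u j - c i *s u j \<in> F i"
      using uF[of j i] i subspace_F[of i]
      by cases (auto intro: subspace_0 subspace_diff subspace_scale)
  qed
  finally show ?thesis .
qed

text \<open>Agreement of \<open>U\<close> with the intersections is asked only up to
  \<open>d\<close>, since the families \<open>E\<close> and \<open>E'\<close> are arbitrary beyond
  that index.\<close>

lemma decomposition_map_triangular:
  assumes U: "\<And>i. i \<le> d \<Longrightarrow> U i = F (Suc i) \<inter> G i"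
  shows "Vector_Spaces.linear scale scale (decomposition_map scale d q U)"
    and "\<lbrakk>i \<le> d; v \<in> F (Suc i)\<rbrakk> \<Longrightarrow>
      decomposition_map scale d q U v - q powi (int d - 2 * int i) *s v \<in> F i"
proof -
  have "\<exists>!f. Vector_Spaces.linear scale scale f \<and>
      (\<forall>i\<le>d. \<forall>u\<in>U i. f u = (q powi (int d - 2 * int i)) *s u)"
    using decomposition_map_ex1[of "\<lambda>i. q powi (int d - 2 * int i)"] U by simp
  from theI'[OF this] have *: "Vector_Spaces.linear scale scale (decomposition_map scale d q U)"
    "\<And>i u. i \<le> d \<Longrightarrow> u \<in> U i \<Longrightarrow>
      decomposition_map scale d q U u = q powi (int d - 2 * int i) *s u"
    unfolding decomposition_map_def by blast+
  then show "Vector_Spaces.linear scale scale (decomposition_map scale d q U)" by blast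
  show "decomposition_map scale d q U v - q powi (int d - 2 * int i) *s v \<in> F i"
    if "i \<le> d" "v \<in> F (Suc i)"
    using split_map_triangular[of _ "\<lambda>i. q powi (int d - 2 * int i)", OF *(1) _ that] *(2) U
    by simp
qed

end

section \<open>From TD systems to flag pairs\<close>

context vector_space
begin

lemma primitive_idempotent_range:
  assumes "primitive_idempotent scale f W E"
  shows "\<exists>c. W = eigenspace scale f c" and "W \<noteq> {0}" and "subspace W"
proof -
  show "\<exists>c. W = eigenspace scale f c" "W \<noteq> {0}"
    using assms by (auto simp: primitive_idempotent_def eigenspaces_def)
  have "module_hom scale scale E" and W: "W = range E"
    using assms by (auto simp: primitive_idempotent_def linear_iff_module_hom)
  then show "subspace W"
    unfolding W by (intro module_hom.subspace_image[of scale scale E] subspace_UNIV)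
qed

lemma TD_system_eigenvector:
  assumes "TD_system scale A E A' E' d" "i \<le> d"
  shows "\<exists>c. range (E i) = eigenspace scale A c" and "\<exists>c. range (E' i) = eigenspace scale A' c"
    and "range (E i) \<noteq> {0}" and "range (E' i) \<noteq> {0}"
    and "subspace (range (E i))" and "subspace (range (E' i))"
proof -
  have "primitive_idempotent scale A (range (E i)) (E i)"
    "primitive_idempotent scale A' (range (E' i)) (E' i)"
    using assms by (simp_all add: TD_system_def)
  note primitive_idempotent_range[OF this(1)] primitive_idempotent_range[OF this(2)]
  then show "\<exists>c. range (E i) = eigenspace scale A c" "\<exists>c. range (E' i) = eigenspace scale A' c"
    "range (E i) \<noteq> {0}" "range (E' i) \<noteq> {0}"
    "subspace (range (E i))" "subspace (range (E' i))"
    by - assumption+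
qed

lemma standard_ordering_span:
  assumes "standard_ordering scale A A' d W" "diagonalizable scale A"
  shows "span (\<Union>j\<le>d. W j) = UNIV"
  using assms unfolding standard_ordering_def diagonalizable_def bij_betw_def by simp

text \<open>The free index set \<open>J\<close> lets one statement serve initial segments (the flag
  of \<open>A'\<close>) and final segments (the flag of \<open>A\<close>).\<close>

lemma standard_ordering_tridiagonal:
  assumes "standard_ordering scale A A' d W" "\<And>j. j \<le> d \<Longrightarrow> subspace (W j)"
    and "i \<le> d" "x \<in> W i" "{j. j \<le> d \<and> \<bar>int j - int i\<bar> \<le> 1} \<subseteq> J"
  shows "A' x \<in> span (\<Union>j\<in>J. W j)"
proof -
  let ?I = "{j. j \<le> d \<and> \<bar>int j - int i\<bar> \<le> 1}"
  have "A' x \<in> (\<Sum>j\<in>?I. W j)"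
    using assms(1,3,4) by (auto simp: standard_ordering_def)
  also have "\<dots> = span (\<Union>j\<in>?I. W j)"
    using assms(2) by (intro sum_subspaces_eq_span) auto
  also have "\<dots> \<subseteq> span (\<Union>j\<in>J. W j)"
    using assms(5) by (intro span_mono) blast
  finally show ?thesis .
qed

text \<open>The tridiagonal condition is symmetric under \<open>i \<mapsto> d - i\<close>. This
  turns results on the first split decomposition into results on the second.\<close>

lemma TD_system_reverse:
  assumes "TD_system scale A E A' E' d"
  shows "TD_system scale A (\<lambda>i. E (d - i)) A' E' d"
proof -
  have rev: "bij_betw (\<lambda>i. d - i) {..d} {..d}"
    by (rule bij_betw_byWitness[of _ "\<lambda>i. d - i"]) auto
  have so: "standard_ordering scale A A' d (\<lambda>i. range (E i))"
    using assms by (simp add: TD_system_def)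
  have "bij_betw (\<lambda>i. range (E (d - i))) {..d} (eigenspaces scale A)"
    using bij_betw_trans[OF rev, of "\<lambda>i. range (E i)"] so
    by (simp add: standard_ordering_def comp_def)
  moreover have "A' ` range (E (d - i)) \<subseteq>
      (\<Sum>j\<in>{j. j \<le> d \<and> \<bar>int j - int i\<bar> \<le> 1}. range (E (d - j)))" if "i \<le> d" for i
  proof -
    have "(\<Sum>j\<in>{j. j \<le> d \<and> \<bar>int j - int i\<bar> \<le> 1}. range (E (d - j))) =
        (\<Sum>j\<in>{j. j \<le> d \<and> \<bar>int j - int (d - i)\<bar> \<le> 1}. range (E j))"
      using that
      by (intro sum.reindex_bij_witness[of _ "\<lambda>i. d - i" "\<lambda>i. d - i"]) auto
    moreover have "A' ` range (E (d - i)) \<subseteq>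
        (\<Sum>j\<in>{j. j \<le> d \<and> \<bar>int j - int (d - i)\<bar> \<le> 1}. range (E j))"
      using so diff_le_self[of d i] unfolding standard_ordering_def by blast
    ultimately show ?thesis by simp
  qed
  ultimately show ?thesis
    using assms by (simp add: TD_system_def standard_ordering_def)
qed

lemma TD_system_flag_pair:
  assumes TD: "TD_system scale A E A' E' d"
  shows "flag_pair scale A A' (\<lambda>i. span (\<Union>j\<in>{j. j < i \<and> j \<le> d}. range (E' j)))
    (\<lambda>i. span (\<Union>j\<in>{i..d}. range (E j))) d"
    (is "flag_pair scale A A' ?F ?G d")
proof -
  note eig = TD_system_eigenvector[OF TD]
  have lin: "Vector_Spaces.linear scale scale A" "Vector_Spaces.linear scale scale A'"
    and diag: "diagonalizable scale A" "diagonalizable scale A'"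
    and so: "standard_ordering scale A A' d (\<lambda>i. range (E i))"
      "standard_ordering scale A' A d (\<lambda>i. range (E' i))"
    and prim: "\<And>i. i \<le> d \<Longrightarrow> primitive_idempotent scale A (range (E i)) (E i)"
    and irr: "\<And>W. subspace W \<Longrightarrow> A ` W \<subseteq> W \<Longrightarrow> A' ` W \<subseteq> W \<Longrightarrow> W = {0} \<or> W = UNIV"
    using TD by (auto simp: TD_system_def TD_pair_def)
  interpret A: Vector_Spaces.linear scale scale A by (rule lin)
  interpret A': Vector_Spaces.linear scale scale A' by (rule lin)
  show ?thesis
  proof
    show "subspace (?F i)" "subspace (?G i)" for i by auto
    show "?F i \<subseteq> ?F (Suc i)" for i by (rule span_mono, rule UN_mono) auto
    show "?G (Suc i) \<subseteq> ?G i" for i by (rule span_mono, rule UN_mono) auto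
    show "?F 0 = {0}" by simp
    show "?F i = UNIV" if "d < i" for i
    proof -
      have "{j. j < i \<and> j \<le> d} = {..d}" using that by auto
      then show ?thesis using standard_ordering_span[OF so(2) diag(2)] by simp
    qed
    show "?G 0 = UNIV"
      using standard_ordering_span[OF so(1) diag(1)] by (simp add: atLeast0AtMost)
    show "?G i = {0}" if "d < i" for i using that by simp
    have "range (E' 0) \<subseteq> ?F (Suc 0)"
      by (rule order_trans[OF _ span_superset]) auto
    then show "?F (Suc 0) \<noteq> {0}"
      using eig(4)[of 0] subspace_0[OF eig(6)[of 0]] by auto
    \<comment> \<open>\<open>E 0\<close> kills every \<open>range (E j)\<close> with
      \<open>1 \<le> j \<le> d\<close>; if these spanned the space, \<open>E 0\<close> would be
      zero, although its range is not.\<close>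
    show "?G (Suc 0) \<noteq> UNIV"
    proof
      assume full: "?G (Suc 0) = UNIV"
      have "primitive_idempotent scale A (range (E 0)) (E 0)" by (rule prim) simp
      then have E0: "Vector_Spaces.linear scale scale (E 0)"
        "\<forall>W\<in>eigenspaces scale A - {range (E 0)}. \<forall>v\<in>W. E 0 v = 0"
        unfolding primitive_idempotent_def by blast+
      have inj: "inj_on (\<lambda>i. range (E i)) {..d}"
        and mem: "(\<lambda>i. range (E i)) ` {..d} = eigenspaces scale A"
        using so(1) by (simp_all add: standard_ordering_def bij_betw_def)
      have "E 0 x = 0" if x: "x \<in> (\<Union>j\<in>{Suc 0..d}. range (E j))" for x
      proof -
        obtain j where j: "j \<in> {Suc 0..d}" "x \<in> range (E j)"
          using x by (rule UN_E)
        have "range (E j) \<noteq> range (E 0)"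
          using inj_onD[OF inj, of j 0] j(1) by auto
        moreover have "range (E j) \<in> eigenspaces scale A"
          unfolding mem[symmetric] using j(1) by (intro image_eqI[of _ _ j]) simp_all
        ultimately show ?thesis
          using E0(2) j(2) by (metis DiffI singletonD)
      qed
      then have "E 0 x \<in> {0}" for x
        using linear_span_into[OF E0(1) subspace_single_0,
            of "\<Union>j\<in>{Suc 0..d}. range (E j)" x] full
        by simp
      then show False using eig(3)[of 0] by auto
    qed
    show "A x \<in> ?F (Suc i)" if "x \<in> ?F i" for x i
    proof (rule linear_span_into[OF lin(1) _ _ that])
      fix y assume "y \<in> (\<Union>j\<in>{j. j < i \<and> j \<le> d}. range (E' j))"
      then obtain j where "j < i" "j \<le> d" "y \<in> range (E' j)" by blast
      then show "A y \<in> ?F (Suc i)"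
        using eig(6) by (intro standard_ordering_tridiagonal[OF so(2)]) auto
    qed simp
    show "A' x \<in> ?G i" if "x \<in> ?G (Suc i)" for x i
    proof (rule linear_span_into[OF lin(2) _ _ that])
      fix y assume "y \<in> (\<Union>j\<in>{Suc i..d}. range (E j))"
      then obtain j where "j \<in> {Suc i..d}" "y \<in> range (E j)" by (rule UN_E)
      then show "A' y \<in> ?G i"
        using eig(5) by (intro standard_ordering_tridiagonal[OF so(1)]) auto
    qed simp
    \<comment> \<open>Subtracting the eigenvalue on \<open>W i\<close> kills \<open>W i\<close> and
      preserves the other eigenspaces. If \<open>i\<close> is not in \<open>J\<close>, nothing is
      removed and any scalar works, which covers indices beyond \<open>d\<close>.\<close>
    have step: "\<exists>c. \<forall>x\<in>span (\<Union>j\<in>J. W j). f x - scale c x \<in> span (\<Union>j\<in>J - {i}. W j)"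
      if lin_f: "Vector_Spaces.linear scale scale f" and W: "\<And>j. j \<in> J \<Longrightarrow> \<exists>c. W j = eigenspace scale f c"
      for f J W and i :: nat
    proof -
      obtain c where c: "\<And>j x. j \<in> J \<Longrightarrow> x \<in> W j \<Longrightarrow> f x = scale (c j) x"
        using W unfolding eigenspace_def by (metis (mono_tags) mem_Collect_eq)
      have "f y - scale (c i) y \<in> span (\<Union>j\<in>J - {i}. W j)" if y: "y \<in> (\<Union>j\<in>J. W j)" for y
      proof -
        obtain j where j: "j \<in> J" "y \<in> W j" using y by blast
        show ?thesis
        proof (cases "j = i")
          case True
          then show ?thesis using c[OF j] by (simp add: span_zero)
        next
          case False
          with j have "y \<in> span (\<Union>j\<in>J - {i}. W j)"
            by (intro span_base) blast
          then show ?thesis unfolding c[OF j] by (intro span_diff span_scale)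
        qed
      qed
      then show ?thesis
        using linear_span_into[OF linear_diff_scale[OF lin_f] subspace_span] by blast
    qed
    show "\<exists>c. \<forall>x\<in>?G i. A x - scale c x \<in> ?G (Suc i)" for i
    proof -
      have "{i..d} - {i} = {Suc i..d}" by auto
      then show ?thesis
        using step[of A "{i..d}" "\<lambda>j. range (E j)" i] lin(1) eig(1) by simp
    qed
    show "\<exists>c. \<forall>x\<in>?F (Suc i). A' x - scale c x \<in> ?F i" for i
    proof -
      have "{j. j < Suc i \<and> j \<le> d} - {i} = {j. j < i \<and> j \<le> d}" by auto
      then show ?thesis
        using step[of A' "{j. j < Suc i \<and> j \<le> d}" "\<lambda>j. range (E' j)" i] lin(2) eig(2) by simp
    qed
  qed (use irr in \<open>auto simp: A.add A.scale A'.add A'.scale\<close>)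
qed

text \<open>If \<open>a\<close> were its own inverse, the first and last eigenvalues of
  \<open>A\<close> would coincide, and \<open>E 0\<close> and \<open>E d\<close> would share an
  eigenspace.\<close>

lemma q_Racah_a_neq:
  assumes TD: "TD_system scale A E A' E' d" and qR: "q_Racah scale A E A' E' d q a b" and "d \<ge> 1"
  shows "a \<noteq> inverse a"
proof
  assume a: "a = inverse a"
  \<comment> \<open>The common value of the eigenvalue formula at \<open>0\<close> and at
    \<open>d\<close> when \<open>inverse a = a\<close>.\<close>
  define \<theta> where "\<theta> = a * q powi int d + a * q powi (- int d)"
  have "range (E i) = eigenspace scale A \<theta>" if "i \<in> {0, d}" for i
  proof -
    have "i \<le> d" using that by auto
    obtain c where c: "range (E i) = eigenspace scale A c"
      using TD_system_eigenvector(1)[OF TD \<open>i \<le> d\<close>] by blast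
    have "0 \<in> range (E i)"
      using TD_system_eigenvector(5)[OF TD \<open>i \<le> d\<close>] by (rule subspace_0)
    then obtain v where v: "v \<in> range (E i)" "v \<noteq> 0"
      using TD_system_eigenvector(3)[OF TD \<open>i \<le> d\<close>] by blast
    have "A v = scale \<theta> v"
      using qR v(1) that \<open>i \<le> d\<close> a[symmetric]
      unfolding q_Racah_def \<theta>_def by (auto simp: add.commute)
    moreover have "A v = scale c v" using v(1) c by (simp add: eigenspace_def)
    ultimately have "c = \<theta>" using v(2) by simp
    then show ?thesis using c by simp
  qed
  then have "range (E 0) = range (E d)" by simp
  moreover have "inj_on (\<lambda>i. range (E i)) {..d}"
    using TD by (simp add: TD_system_def standard_ordering_def bij_betw_def)
  ultimately show False using \<open>d \<ge> 1\<close> by (auto dest!: inj_onD[where x = 0 and y = d])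
qed

end

section \<open>Triangularity of the map \<open>M\<close> and of its inverse\<close>

theorem lemma10p4:
  fixes scale :: "'k::alg_closed_field \<Rightarrow> 'v::ab_group_add \<Rightarrow> 'v"
    and Basis :: "'v set"
    and A A' :: "'v \<Rightarrow> 'v"
    and E E' :: "nat \<Rightarrow> 'v \<Rightarrow> 'v"
    and d i :: nat
    and q a b :: 'k
  assumes "finite_dimensional_vector_space scale Basis"
    and "vector_space.dim scale (UNIV :: 'v set) > 0"
    and "d \<ge> 1"
    and "TD_system scale A E A' E' d"
    and "q_Racah scale A E A' E' d q a b"
    and "i \<le> d"
  shows "let M = M_map scale E E' d q a in
      (\<lambda>v. M v - scale (q powi (int d - 2 * int i)) v) ` range (E' i)
        \<subseteq> (\<Sum>j\<in>{0..<i}. range (E' j)) \<and>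
      (\<lambda>v. inv M v - scale (q powi (2 * int i - int d)) v) ` range (E' i)
        \<subseteq> (\<Sum>j\<in>{0..<i}. range (E' j))"
proof -
  interpret vector_space scale
    using assms(1) by (rule finite_dimensional_vector_space.axioms)
  note TD = assms(4)
  note TDr = TD_system_reverse[OF TD]
  define F where "F i = span (\<Union>j\<in>{j. j < i \<and> j \<le> d}. range (E' j))" for i
  define G where "G i = span (\<Union>j\<in>{i..d}. range (E j))" for i
  \<comment> \<open>\<open>G\<close> for the reversed ordering: for \<open>i \<le> d\<close> it is
    the sum of \<open>range (E j)\<close> over \<open>j \<le> d - i\<close>, as in
    \<open>split2\<close>. Both flag pairs share \<open>F\<close>, so the two triangular maps can be
    combined.\<close>
  define H where "H i = span (\<Union>j\<in>{i..d}. range (E (d - j)))" for i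
  interpret K: flag_pair scale A A' F G d
    unfolding F_def G_def by (rule TD_system_flag_pair[OF TD])
  interpret B: flag_pair scale A A' F H d
    unfolding F_def H_def by (rule TD_system_flag_pair[OF TDr])
  have span_E: "(\<Sum>j\<in>J. range (E j)) = span (\<Union>j\<in>J. range (E j))"
    and span_E': "(\<Sum>j\<in>J. range (E' j)) = span (\<Union>j\<in>J. range (E' j))"
    if J: "J \<subseteq> {..d}" for J
  proof -
    have "finite J" using J by (rule finite_subset) simp
    moreover have "j \<le> d" if "j \<in> J" for j using J that by blast
    ultimately show "(\<Sum>j\<in>J. range (E j)) = span (\<Union>j\<in>J. range (E j))"
      "(\<Sum>j\<in>J. range (E' j)) = span (\<Union>j\<in>J. range (E' j))"
      by - (rule sum_subspaces_eq_span, assumption, rule TD_system_eigenvector(5,6)[OF TD], blast)+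
  qed
  \<comment> \<open>The bound is \<open>Suc d\<close> because \<open>F (Suc i)\<close> is needed at
    \<open>i = d\<close>; beyond it \<open>F\<close> is cut off at \<open>d\<close> but the sum is
    not.\<close>
  have F: "(\<Sum>j\<in>{0..<i}. range (E' j)) = F i" if "i \<le> Suc d" for i
  proof -
    have "{j. j < i \<and> j \<le> d} = {0..<i}" using that by auto
    moreover have "{0..<i} \<subseteq> {..d}" using that by auto
    ultimately show ?thesis by (simp add: F_def span_E')
  qed
  have FS: "(\<Sum>j\<in>{0..i}. range (E' j)) = F (Suc i)" if "i \<le> d" for i
    using F[of "Suc i"] that by (simp add: atLeastLessThanSuc_atLeastAtMost)
  have s1: "split1 E E' d i = F (Suc i) \<inter> G i" if "i \<le> d" for i
    unfolding split1_def FS[OF that] G_def by (subst span_E) auto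
  have s2: "split2 E E' d i = F (Suc i) \<inter> H i" if "i \<le> d" for i
  proof -
    have "(\<lambda>j. range (E (d - j))) ` {i..d} = (\<lambda>j. range (E j)) ` {0..d - i}"
    proof -
      have "(\<lambda>j. d - j) ` {i..d} = {0..d - i}"
      proof (intro equalityI subsetI)
        fix x assume "x \<in> {0..d - i}"
        then show "x \<in> (\<lambda>j. d - j) ` {i..d}"
          using that by (intro image_eqI[of _ _ "d - x"]) auto
      qed auto
      from this[symmetric] show ?thesis by (simp add: image_image)
    qed
    then show ?thesis
      unfolding split2_def FS[OF that] H_def by (subst span_E) auto
  qed
  define M where "M = M_map scale E E' d q a"
  let ?c = "\<lambda>i. q powi (int d - 2 * int i)"
  let ?K = "K_map scale E E' d q" and ?B = "B_map scale E E' d q"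
  have "a \<noteq> inverse a"
    by (rule q_Racah_a_neq[OF TD assms(5,3)])
  then have a: "a - inverse a \<noteq> 0" by simp
  have q: "q \<noteq> 0" using assms(5) by (simp add: q_Racah_def)
  note K = K.decomposition_map_triangular[OF s1, folded K_map_def]
  note B = B.decomposition_map_triangular[OF s2, folded B_map_def]
  interpret vector_space_pair scale scale by unfold_locales
  have M_lin: "Vector_Spaces.linear scale scale M"
    unfolding M_def M_map_def[abs_def]
    by (intro linear_compose_scale_right linear_compose_sub K(1) B(1))
  have M_tri: "M v - scale (?c i) v \<in> F i" if "i \<le> d" "v \<in> F (Suc i)" for i v
  proof -
    \<comment> \<open>The coefficients of \<open>?K\<close> and \<open>?B\<close> in
      \<open>M\<close> add up to \<open>1\<close>, so the shared diagonal \<open>?c i\<close> passes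
      to \<open>M\<close>.\<close>
    let ?w = "scale (inverse (a - inverse a)) (scale a (?K v - scale (?c i) v)
      - scale (inverse a) (?B v - scale (?c i) v))"
    have "scale a (x - z) - scale (inverse a) (y - z) =
        scale a x - scale (inverse a) y - scale (a - inverse a) z" for x y z
      by (simp only: scale_right_diff_distrib scale_left_diff_distrib) simp
    then have "?w = M v - scale (inverse (a - inverse a)) (scale (a - inverse a) (scale (?c i) v))"
      unfolding M_def M_map_def by (simp only: scale_right_diff_distrib)
    also have "\<dots> = M v - scale (?c i) v"
      using a by simp
    finally have "M v - scale (?c i) v = ?w" by simp
    moreover have "?w \<in> F i"
      by (intro subspace_scale[OF K.subspace_F] subspace_diff[OF K.subspace_F]
          K(2)[OF _ that] B(2)[OF _ that])
    ultimately show ?thesis by simp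
  qed
  \<comment> \<open>The flag reaches the whole space at \<open>Suc d\<close>, the diagonal is
    nonzero because \<open>q \<noteq> 0\<close>, and inverting it negates the exponent.\<close>
  have M_inv: "inv M v - scale (q powi (2 * int i - int d)) v \<in> F i" if "v \<in> F (Suc i)" for v
  proof -
    have "inv M v - scale (inverse (?c i)) v \<in> F i"
      by (rule triangular_inverse[of M F "Suc d" ?c i])
        (use M_lin K.subspace_F K.F_0 K.F_top M_tri K.F_mono q assms(6) that in auto)
    then show ?thesis by (simp flip: power_int_minus)
  qed
  have "range (E' i) \<subseteq> F (Suc i)"
    unfolding F_def using assms(6) by (intro order_trans[OF _ span_superset]) auto
  then show ?thesis
    using M_tri[OF assms(6)] M_inv assms(6) by (auto simp: Let_def F simp flip: M_def)
qed

end
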